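(* Let $\alpha<0$ and $\lambda>0$ be fixed, and let $f,F,s_0,\tilde C$, the points $P_2^\pm$ and the length $L_2(C)$ be as in the context, for $\tilde C<C<s_0$. Then $L_2(\cdot)$ is a monotone decreasing function of $C$ such that $L_2(s_0)=0$ and $L_0:=L_2(\tilde C)<-\frac{2}{\alpha}$. For fixed $L\in(0,L_0)$ there is exactly one trajectory $\widehat{P_2^+P_2^-}$ (i.e. exactly one $C\in(\tilde C,s_0)$ with $L_2(C)=L$) which corresponds to a symmetric solution of $$u''+\lambda f(u)=0\ \text{ in }(0,L),\qquad u'(0)=\alpha u(0),\quad u'(L)=-\alpha u(L).$$
   Context: $f\in C^1(\mathbb{R})$ satisfies $f>0$, $f'\ge 0$ on $\mathbb{R}$, $\lim_{u\to\infty}f(u)/u=\infty$, and $f$ is integrable at $-\infty$. Set $F(u)=\int_{-\infty}^u f(t)\,dt$, $F^{-1}:(0,\infty)\to\mathbb{R}$, $s_0=F(0)$, $\gamma^*=\sqrt{\lambda}/\alpha<0$. For $C>0$ let $\mathcal{K}_C=\{(v,F^{-1}(C-v^2/2)): v^2<2C\}$ in the $(v,u)$-plane, $\mathcal{L}^+=\{(v,\gamma^*v)\}$, $\mathcal{L}^-=\{(v,-\gamma^*v)\}$, $v\in\mathbb{R}$. For a solution $u$ put $v=u'/\sqrt\lambda$; then $(v(x),u(x))$ runs on some $\mathcal{K}_C$, $v$ decreasing, from a point of $\mathcal{L}^+$ ($x=0$) to a point of $\mathcal{L}^-$ ($x=L$). There is a unique $\tilde C<s_0$ for which $\mathcal{L}^\pm$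 are tangent to $\mathcal{K}_{\tilde C}$. For $C>\tilde C$, $\mathcal{L}^+$ meets $\mathcal{K}_C$ in exactly two points $P_i^+=(v_i^+,u_i^+)$, $i=1,2$, with $v_1^+>v_2^+$; their reflections at the $u$-axis are the intersection points $P_i^-=(-v_i^+,u_i^+)$ of $\mathcal{L}^-$ with $\mathcal{K}_C$. For $C=\tilde C$ the two points coincide ($P_1^\pm=P_2^\pm$ is the point of contact). For $\tilde C\le C\le s_0$, $$L_2(C)=2\int_0^{v_2^+}\frac{dv}{\sqrt{\lambda}\,f\left(F^{-1}\left(C-\frac{v^2}{2}\right)\right)},\qquad v_2^+=v_2^+(C),$$ which is the length of the interval of the symmetric solution represented by the arc $\widehat{P_2^+P_2^-}$ of $\mathcal{K}_C$ from $P_2^+$ to $P_2^-$. Symmetric means symmetric with respect to $L/2$.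
   Formalization: The strict bound L_0 < -2/α can fail when f is constant on the u-values of the arc P_2^+P_2^- for C̃ (then L_0 = -2/α); proved are L_0 ≤ -2/α always and L_0 < -2/α whenever f is not constant there. *)

theory Defs
  imports "HOL-Analysis.Analysis"
begin

definition primitive :: "(real \<Rightarrow> real) \<Rightarrow> real \<Rightarrow> real" where
  "primitive f u = integral {..u} f"

text \<open>
  For the nonlinearities considered here, \<open>primitive f\<close> is a bijection from the reals onto the
  positive reals, so \<open>primitive_inv f\<close> is meaningful exactly at positive arguments.
\<close>

definition primitive_inv :: "(real \<Rightarrow> real) \<Rightarrow> real \<Rightarrow> real" where
  "primitive_inv f = inv (primitive f)"

definition gamma_star :: "real \<Rightarrow> real \<Rightarrow> real" where
  "gamma_star lam \<alpha> = sqrt lam / \<alpha>"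

text \<open>
  With \<open>v = u' / sqrt lam\<close>, the quantity \<open>v\<^sup>2 / 2 + primitive f u\<close> is constant along solutions of
  \<open>u'' + lam * f u = 0\<close>. Its level set for the value \<open>C\<close>, in the \<open>(v, u)\<close>-plane, is the graph of
  \<open>level f C\<close> over \<open>v\<^sup>2 < 2 * C\<close>.
\<close>

definition level :: "(real \<Rightarrow> real) \<Rightarrow> real \<Rightarrow> real \<Rightarrow> real" where
  "level f C v = primitive_inv f (C - v\<^sup>2 / 2)"

definition level_curve :: "(real \<Rightarrow> real) \<Rightarrow> real \<Rightarrow> (real \<times> real) set" where
  "level_curve f C = {(v, level f C v) | v. v\<^sup>2 < 2 * C}"

definition line :: "real \<Rightarrow> (real \<times> real) set" where
  "line m = {(v, m * v) | v. True}"

definition line_tangent_to_level :: "real \<Rightarrow> (real \<Rightarrow> real) \<Rightarrow> real \<Rightarrow> bool" where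
  "line_tangent_to_level m f C \<longleftrightarrow>
     (\<exists>v u. (v, u) \<in> level_curve f C \<inter> line m \<and> (level f C has_real_derivative m) (at v))"

definition C_tilde :: "(real \<Rightarrow> real) \<Rightarrow> real \<Rightarrow> real \<Rightarrow> real" where
  "C_tilde f lam \<alpha> =
     (THE C. C < primitive f 0 \<and>
        line_tangent_to_level (gamma_star lam \<alpha>) f C \<and>
        line_tangent_to_level (- gamma_star lam \<alpha>) f C)"

text \<open>
  For \<open>C > C_tilde f lam \<alpha>\<close> the line of slope \<open>gamma_star lam \<alpha>\<close> meets the level curve in two points,
  and \<open>v2\<close> is the smaller of their abscissae; for \<open>C = C_tilde f lam \<alpha>\<close> the point of contact is the
  only intersection point.
\<close>

definition v2 :: "(real \<Rightarrow> real) \<Rightarrow> real \<Rightarrow> real \<Rightarrow> real \<Rightarrow> real" where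
  "v2 f lam \<alpha> C = Min (fst ` (level_curve f C \<inter> line (gamma_star lam \<alpha>)))"

definition P2_plus :: "(real \<Rightarrow> real) \<Rightarrow> real \<Rightarrow> real \<Rightarrow> real \<Rightarrow> real \<times> real" where
  "P2_plus f lam \<alpha> C = (v2 f lam \<alpha> C, gamma_star lam \<alpha> * v2 f lam \<alpha> C)"

definition P2_minus :: "(real \<Rightarrow> real) \<Rightarrow> real \<Rightarrow> real \<Rightarrow> real \<Rightarrow> real \<times> real" where
  "P2_minus f lam \<alpha> C = (- v2 f lam \<alpha> C, gamma_star lam \<alpha> * v2 f lam \<alpha> C)"

definition arc2 :: "(real \<Rightarrow> real) \<Rightarrow> real \<Rightarrow> real \<Rightarrow> real \<Rightarrow> (real \<times> real) set" where
  "arc2 f lam \<alpha> C = {(v, u) \<in> level_curve f C. - v2 f lam \<alpha> C \<le> v \<and> v \<le> v2 f lam \<alpha> C}"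

definition L2 :: "(real \<Rightarrow> real) \<Rightarrow> real \<Rightarrow> real \<Rightarrow> real \<Rightarrow> real" where
  "L2 f lam \<alpha> C =
     2 * integral {0..v2 f lam \<alpha> C}
           (\<lambda>v. 1 / (sqrt lam * f (primitive_inv f (C - v\<^sup>2 / 2))))"

text \<open>
  Classical solutions on \<open>[0, L]\<close>: \<open>u'\<close> is the derivative of \<open>u\<close> (one-sided at the end points), is
  continuous up to the boundary, and the differential equation holds in the open interval.
\<close>

definition robin_solution ::
  "(real \<Rightarrow> real) \<Rightarrow> real \<Rightarrow> real \<Rightarrow> real \<Rightarrow> (real \<Rightarrow> real) \<Rightarrow> (real \<Rightarrow> real) \<Rightarrow> bool" where
  "robin_solution f lam \<alpha> L u u' \<longleftrightarrow>
     (\<forall>x\<in>{0..L}. (u has_real_derivative u' x) (at x within {0..L})) \<and>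
     continuous_on {0..L} u' \<and>
     (\<forall>x\<in>{0<..<L}. \<exists>u''. (u' has_real_derivative u'') (at x) \<and> u'' + lam * f (u x) = 0) \<and>
     u' 0 = \<alpha> * u 0 \<and> u' L = - \<alpha> * u L"

definition symmetric_on :: "real \<Rightarrow> (real \<Rightarrow> real) \<Rightarrow> bool" where
  "symmetric_on L u \<longleftrightarrow> (\<forall>x\<in>{0..L}. u (L - x) = u x)"

definition represented_by_arc2 ::
  "(real \<Rightarrow> real) \<Rightarrow> real \<Rightarrow> real \<Rightarrow> real \<Rightarrow> real \<Rightarrow> (real \<Rightarrow> real) \<Rightarrow> (real \<Rightarrow> real) \<Rightarrow> bool" where
  "represented_by_arc2 f lam \<alpha> C L u u' \<longleftrightarrow>
     (let traj = (\<lambda>x. (u' x / sqrt lam, u x)) in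
        traj 0 = P2_plus f lam \<alpha> C \<and> traj L = P2_minus f lam \<alpha> C \<and>
        traj ` {0..L} = arc2 f lam \<alpha> C)"

end

theory Submission
  imports Defs
begin

text \<open>
  Write \<open>F\<close> for the primitive, \<open>\<gamma> < 0\<close> for the slope of the line, and let \<open>H v = F (\<gamma> * v) + v\<^sup>2 / 2\<close>
  be the level of the point of the line with abscissa \<open>v\<close>. Since \<open>f\<close> is nondecreasing, \<open>H\<close> is strictly
  convex; it has a unique critical point \<open>contact\<close>, which is positive and satisfies
  \<open>contact = - \<gamma> * f (\<gamma> * contact)\<close>. Tangency of line and level curve means being at this point
  (\<open>C_tilde_eq\<close>), and \<open>H\<close> maps \<open>[0, contact]\<close> decreasingly onto the range of levels considered, with
  \<open>v2\<close> as its inverse (\<open>v2_H\<close>). Everything is therefore parametrised by \<open>w = v2 C\<close> instead of \<open>C\<close>.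

  The length is, up to a constant, the integral over \<open>v\<close> in \<open>[0, w]\<close> of the reciprocal of \<open>f u\<close> along
  the curve. As \<open>C\<close> grows, \<open>w\<close> shrinks, and for each fixed \<open>v\<close> also \<open>u\<close> grows; so the
  positive integrand does not increase while the range of integration shrinks, and the length is
  strictly decreasing
  (\<open>travel_strict_mono\<close>). At the level of contact, bounding \<open>f u\<close> below by its value \<open>f (\<gamma> * contact)\<close>
  at the end points gives the bound \<open>- 2 / \<alpha>\<close>, by the equation for \<open>contact\<close>; equality forces \<open>f\<close> to
  be constant on the arc. After rescaling to a fixed interval the length is seen to be continuous in
  \<open>w\<close> (\<open>travel_continuous\<close>), and the intermediate value theorem yields every length between the two
  extreme ones.

  Finally, arcs and solutions correspond by separation of variables. The odd antiderivative \<open>T\<close> of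
  the integrand, divided by \<open>sqrt lam\<close>, is a clock: along a solution \<open>T (v x) + x\<close> is constant, so
  the length of the interval is \<open>2 * T w\<close> (\<open>represented_imp_length\<close>); conversely the inverse of \<open>T\<close>
  gives \<open>v\<close> as a function of \<open>x\<close> and hence a solution, symmetric because \<open>T\<close> is odd
  (\<open>length_imp_represented\<close>).
\<close>

section \<open>The primitive and its inverse\<close>

text \<open>
  Along an open set on which it is injective, a continuous real function has a differentiable
  inverse at every point of nonzero derivative; continuity of the inverse comes for free from
  invariance of domain.
\<close>

lemma has_real_derivative_local_inverse:
  fixes h g :: "real \<Rightarrow> real"
  assumes "open S" "x \<in> S" "continuous_on S h" "\<And>z. z \<in> S \<Longrightarrow> g (h z) = z"
    and "(h has_real_derivative D) (at x)" "D \<noteq> 0"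
  shows "(g has_real_derivative inverse D) (at (h x))"
  unfolding has_field_derivative_def
proof (rule has_derivative_inverse_strong[OF assms(1-4)])
  show "(h has_derivative (*) D) (at x)"
    using assms(5) by (simp add: has_field_derivative_def)
  show "(*) D \<circ> (*) (inverse D) = id"
    using \<open>D \<noteq> 0\<close> by (auto simp: fun_eq_iff)
qed

locale nonlinearity =
  fixes f f' :: "real \<Rightarrow> real"
  assumes f_deriv: "\<And>u. (f has_real_derivative f' u) (at u)"
    and f_pos: "\<And>u. f u > 0"
    and f'_nonneg: "\<And>u. f' u \<ge> 0"
    and f_integrable_0: "f integrable_on {..0}"
begin

abbreviation F :: "real \<Rightarrow> real" where "F \<equiv> primitive f"
abbreviation G :: "real \<Rightarrow> real" where "G \<equiv> primitive_inv f"

lemma f_mono: "x \<le> y \<Longrightarrow> f x \<le> f y"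
  using DERIV_nonneg_imp_nondecreasing[of x y f] f_deriv f'_nonneg by blast

lemma f_continuous: "continuous_on A f"
  using f_deriv by (meson DERIV_continuous_on DERIV_subset subset_UNIV)

lemma f_integrable_interval: "f integrable_on {a..b}"
  by (intro integrable_continuous_real f_continuous)

lemma f_integrable: "f integrable_on {..u}"
proof -
  have *: "{..u} = {..min u 0} \<union> {min u 0..u}" by auto
  have "f absolutely_integrable_on {..0}"
    using f_integrable_0 f_pos by (intro nonnegative_absolutely_integrable_1) (auto intro: less_imp_le)
  then have "f absolutely_integrable_on {..min u 0}"
    by (rule set_integrable_subset) auto
  then have "f integrable_on {..min u 0}"
    using absolutely_integrable_on_def by blast
  moreover have "negligible ({..min u 0} \<inter> {min u 0..u})"
    by (rule negligible_subset[of "{min u 0}"]) auto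
  ultimately show ?thesis
    unfolding * using f_integrable_interval integrable_Un by blast
qed

lemma F_split:
  assumes "a \<le> u"
  shows "F u = F a + integral {a..u} f"
proof -
  have *: "{..u} = {..a} \<union> {a..u}" using assms by auto
  have "negligible ({..a} \<inter> {a..u})"
    by (rule negligible_subset[of "{a}"]) auto
  then show ?thesis
    unfolding primitive_def * using f_integrable f_integrable_interval by (simp add: integral_Un)
qed

lemma F_deriv: "(F has_real_derivative f u) (at u)"
proof -
  have "((\<lambda>x. integral {u-1..x} f) has_real_derivative f u) (at u within {u-1..u+1})"
    by (intro integral_has_real_derivative f_continuous) auto
  then have "((\<lambda>x. integral {u-1..x} f) has_real_derivative f u) (at u within {u-1<..<u+1})"
    by (rule DERIV_subset) auto
  then have "((\<lambda>x. F (u-1) + integral {u-1..x} f) has_real_derivative f u) (at u within {u-1<..<u+1})"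
    by (auto intro!: derivative_eq_intros)
  then have "((\<lambda>x. F (u-1) + integral {u-1..x} f) has_real_derivative f u) (at u)"
    by (simp add: at_within_open[of u "{u-1<..<u+1}"])
  then show ?thesis
    by (rule has_field_derivative_transform_within_open[where S = "{u-1<..<u+1}"])
      (auto simp: F_split[of "u-1", symmetric])
qed

lemma F_strict_mono: "x < y \<Longrightarrow> F x < F y"
  using DERIV_pos_imp_increasing[of x y F] F_deriv f_pos by blast

lemma F_less_iff: "F x < F y \<longleftrightarrow> x < y"
  using F_strict_mono by (metis less_asym not_less_iff_gr_or_eq)

lemma F_le_iff: "F x \<le> F y \<longleftrightarrow> x \<le> y"
  by (meson F_less_iff linorder_not_le)

lemma F_continuous: "continuous_on A F"
  using F_deriv by (meson DERIV_continuous_on DERIV_subset subset_UNIV)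

lemma F_pos: "F u > 0"
proof -
  have "F (u - 1) \<ge> 0"
    unfolding primitive_def using f_pos by (intro integral_nonneg f_integrable) (auto intro: less_imp_le)
  then show ?thesis using F_strict_mono[of "u-1" u] by simp
qed

text \<open>
  An integral over \<open>{..0}\<close> is the limit of the integrals over \<open>{-B..0}\<close>, and the difference of the
  two is \<open>F (-B)\<close>.
\<close>

lemma F_arbitrarily_small:
  assumes "e > 0"
  shows "\<exists>u. F u < e"
proof -
  have "(f has_integral F 0) {..0}"
    unfolding primitive_def using f_integrable_0 by (rule integrable_integral)
  with assms obtain B where "B > 0" and
    B: "\<And>a b. ball 0 B \<subseteq> cbox a b \<Longrightarrow>
          norm (integral (cbox a b) (\<lambda>x. if x \<in> {..0} then f x else 0) - F 0) < e"
    unfolding has_integral_alt' by meson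
  have "ball 0 B \<subseteq> cbox (-B) B"
    by (auto simp: dist_norm)
  from B[OF this] have "norm (integral ({-B..B} \<inter> {..0}) f - F 0) < e"
    by (simp only: box_real integral_restrict_Int Int_commute)
  moreover have "{-B..B} \<inter> {..0} = {-B..0}" using \<open>B > 0\<close> by auto
  ultimately have "\<bar>integral {-B..0} f - F 0\<bar> < e"
    by (simp only: real_norm_def)
  with F_split[of "-B" 0] F_pos[of "-B"] \<open>B > 0\<close> have "F (-B) < e" by simp
  then show ?thesis by blast
qed

lemma F_unbounded: "\<exists>u. F u > c"
proof -
  define u where "u = \<bar>c\<bar> / f 0"
  have "u \<ge> 0" using f_pos[of 0] by (simp add: u_def)
  have "integral {0..u} (\<lambda>_. f 0) \<le> integral {0..u} f"
    by (intro integral_le f_integrable_interval) (auto intro: f_mono)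
  then have "F u \<ge> F 0 + \<bar>c\<bar>"
    using F_split[OF \<open>u \<ge> 0\<close>] \<open>u \<ge> 0\<close> f_pos[of 0] by (simp add: u_def)
  then show ?thesis using F_pos[of 0] by (intro exI[of _ u]) linarith
qed

lemma F_surj:
  assumes "c > 0"
  shows "\<exists>u. F u = c"
proof -
  from F_arbitrarily_small[OF assms] obtain a where a: "F a < c" ..
  from F_unbounded obtain b where b: "F b > c" ..
  have "a \<le> b" using a b F_less_iff[of a b] by linarith
  then show ?thesis
    using IVT'[of F a c b] a b F_continuous by auto
qed

lemma G_F [simp]: "G (F u) = u"
proof -
  have "inj F" using F_less_iff by (metis injI less_irrefl linorder_less_linear)
  then show ?thesis by (simp add: primitive_inv_def)
qed

lemma F_G: "c > 0 \<Longrightarrow> F (G c) = c"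
  using F_surj[of c] by auto

lemma G_mono: "0 < c \<Longrightarrow> c \<le> d \<Longrightarrow> G c \<le> G d"
  using F_G[of c] F_G[of d] F_le_iff[of "G c" "G d"] by simp

lemma G_deriv:
  assumes "c > 0"
  shows "(G has_real_derivative 1 / f (G c)) (at c)"
proof -
  have "(G has_real_derivative inverse (f (G c))) (at (F (G c)))"
    using f_pos[of "G c"]
    by (intro has_real_derivative_local_inverse[where S = UNIV] F_deriv F_continuous) auto
  then show ?thesis by (simp add: F_G assms inverse_eq_divide)
qed

text \<open>
  With \<open>v = u' / sqrt lam\<close> as parameter on a level curve, the equation reads
  \<open>dv / dx = - sqrt lam * f u\<close>; hence \<open>slowness (C - v\<^sup>2 / 2) / sqrt lam\<close> is the length of the
  \<open>x\<close>-interval spent per unit of \<open>v\<close>.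
\<close>

definition slowness :: "real \<Rightarrow> real" where
  "slowness c = 1 / f (G c)"

lemma slowness_pos: "slowness c > 0"
  by (simp add: slowness_def f_pos)

lemma slowness_antimono: "0 < c \<Longrightarrow> c \<le> d \<Longrightarrow> slowness d \<le> slowness c"
  unfolding slowness_def by (intro divide_left_mono f_mono G_mono mult_pos_pos f_pos) auto

lemma slowness_continuous: "continuous_on {0<..} slowness"
proof -
  have "continuous_on {0<..} G"
    by (rule DERIV_continuous_on, rule DERIV_subset[OF G_deriv]) auto
  then show ?thesis
    unfolding slowness_def using f_pos
    by (intro continuous_intros continuous_on_compose2[OF f_continuous[of UNIV]]) (auto simp: less_imp_neq[symmetric])
qed

lemma level_deriv:
  assumes "v\<^sup>2 < 2 * C"
  shows "(level f C has_real_derivative - v * slowness (C - v\<^sup>2 / 2)) (at v)"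
proof -
  have "((\<lambda>v. C - v\<^sup>2 / 2) has_real_derivative - v) (at v)"
    by (auto intro!: derivative_eq_intros)
  moreover have "(G has_real_derivative slowness (C - v\<^sup>2 / 2)) (at (C - v\<^sup>2 / 2))"
    unfolding slowness_def using assms by (intro G_deriv) simp
  ultimately have "((\<lambda>v. G (C - v\<^sup>2 / 2)) has_real_derivative slowness (C - v\<^sup>2 / 2) * - v) (at v)"
    by (rule DERIV_chain2[rotated])
  then show ?thesis
    by (simp add: level_def[abs_def] mult.commute)
qed

lemma slowness_on_level_continuous:
  assumes "\<And>v. v \<in> A \<Longrightarrow> v\<^sup>2 < 2 * C"
  shows "continuous_on A (\<lambda>v. slowness (C - v\<^sup>2 / 2))"
  by (rule continuous_on_compose2[OF slowness_continuous]) (auto intro!: continuous_intros dest: assms)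

end

section \<open>Intersections of the level curves with the lines\<close>

locale robin_problem = nonlinearity +
  fixes lam \<alpha> :: real
  assumes alpha_neg: "\<alpha> < 0" and lam_pos: "lam > 0"
begin

abbreviation \<gamma> :: real where "\<gamma> \<equiv> gamma_star lam \<alpha>"

lemma gamma_neg: "\<gamma> < 0"
  using alpha_neg lam_pos by (simp add: gamma_star_def divide_pos_neg)

text \<open>
  \<open>H v\<close> is the level of the point \<open>(v, \<gamma> * v)\<close> of the line, so that the intersections of the line
  with the level curve for \<open>C\<close> are the solutions of \<open>H v = C\<close>.
\<close>

definition H :: "real \<Rightarrow> real" where
  "H v = F (\<gamma> * v) + v\<^sup>2 / 2"

definition H' :: "real \<Rightarrow> real" where
  "H' v = v + \<gamma> * f (\<gamma> * v)"

lemma H_0: "H 0 = F 0"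
  by (simp add: H_def)

lemma H_deriv: "(H has_real_derivative H' v) (at v)"
proof -
  have "((\<lambda>v. F (\<gamma> * v)) has_real_derivative f (\<gamma> * v) * \<gamma>) (at v)"
    by (rule DERIV_chain2[OF F_deriv]) (auto intro!: derivative_eq_intros)
  then show ?thesis
    unfolding H_def[abs_def] H'_def by (auto intro!: derivative_eq_intros)
qed

lemma H_continuous: "continuous_on A H"
  using H_deriv by (meson DERIV_continuous_on DERIV_subset subset_UNIV)

lemma H'_strict_mono:
  assumes "x < y"
  shows "H' x < H' y"
proof -
  have "\<gamma> * y \<le> \<gamma> * x" using assms gamma_neg by simp
  then have "\<gamma> * f (\<gamma> * x) \<le> \<gamma> * f (\<gamma> * y)"
    using f_mono[of "\<gamma> * y" "\<gamma> * x"] gamma_neg by simp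
  then show ?thesis using assms by (simp add: H'_def)
qed

text \<open>
  The derivative of \<open>H\<close> is strictly increasing and changes sign between \<open>0\<close> and \<open>- \<gamma> * f 0\<close>, because
  \<open>f (\<gamma> * v) \<le> f 0\<close> for \<open>v \<ge> 0\<close>. Its zero is the abscissa of the point of contact and separates the
  two families of intersection points.
\<close>

definition contact :: real where
  "contact = (THE v. H' v = 0)"

lemma H'_contact: "H' contact = 0"
  and contact_pos: "contact > 0"
proof -
  let ?b = "- \<gamma> * f 0"
  have "?b > 0" using gamma_neg f_pos[of 0] by (simp add: mult_neg_pos)
  have "H' 0 < 0" using gamma_neg f_pos[of 0] by (simp add: H'_def mult_neg_pos)
  have "f (\<gamma> * ?b) \<le> f 0"
    using gamma_neg \<open>?b > 0\<close> by (intro f_mono mult_nonpos_nonneg) auto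
  then have "H' ?b \<ge> 0"
    using mult_left_mono_neg[of "f (\<gamma> * ?b)" "f 0" \<gamma>] gamma_neg by (simp add: H'_def)
  moreover have "continuous_on {0..?b} H'"
    unfolding H'_def[abs_def]
    by (intro continuous_intros continuous_on_compose2[OF f_continuous[of UNIV]]) auto
  ultimately obtain v where v: "0 \<le> v" "H' v = 0"
    using IVT'[of H' 0 0 ?b] \<open>H' 0 < 0\<close> \<open>?b > 0\<close> by auto
  have "contact = v"
    unfolding contact_def using v(2)
    by (rule the_equality) (metis H'_strict_mono less_irrefl linorder_less_linear v(2))
  with v \<open>H' 0 < 0\<close> show "H' contact = 0" "contact > 0"
    by (auto simp: less_le)
qed

lemma contact_unique: "H' v = 0 \<Longrightarrow> v = contact"
  using H'_contact H'_strict_mono by (metis less_irrefl linorder_less_linear)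

lemma H_decreasing:
  assumes "x < y" "y \<le> contact"
  shows "H y < H x"
proof (rule DERIV_neg_imp_decreasing_open[OF assms(1)])
  show "\<exists>d. (H has_real_derivative d) (at z) \<and> d < 0" if "x < z" "z < y" for z
    using H_deriv[of z] H'_strict_mono[of z contact] H'_contact that assms by force
qed (rule H_continuous)

lemma H_increasing:
  assumes "contact \<le> x" "x < y"
  shows "H x < H y"
proof (rule DERIV_pos_imp_increasing_open[OF assms(2)])
  show "\<exists>d. (H has_real_derivative d) (at z) \<and> d > 0" if "x < z" "z < y" for z
    using H_deriv[of z] H'_strict_mono[of contact z] H'_contact that assms by force
qed (rule H_continuous)

lemma H_range:
  assumes "H contact \<le> C" "C \<le> F 0"
  obtains w where "0 \<le> w" "w \<le> contact" "H w = C"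
  using IVT2'[of H contact C 0] assms contact_pos H_continuous by (auto simp: H_0)

lemma level_curve_iff: "(v, u) \<in> level_curve f C \<longleftrightarrow> F u + v\<^sup>2 / 2 = C"
proof
  assume "(v, u) \<in> level_curve f C"
  then have "u = G (C - v\<^sup>2 / 2)" "v\<^sup>2 < 2 * C"
    by (auto simp: level_curve_def level_def)
  then show "F u + v\<^sup>2 / 2 = C" by (simp add: F_G)
next
  assume *: "F u + v\<^sup>2 / 2 = C"
  then have "C - v\<^sup>2 / 2 = F u" by simp
  moreover have "v\<^sup>2 < 2 * C" using * F_pos[of u] by simp
  ultimately show "(v, u) \<in> level_curve f C"
    by (simp add: level_curve_def level_def)
qed

lemma level_curve_meets_line_iff:
  "(v, u) \<in> level_curve f C \<inter> line \<gamma> \<longleftrightarrow> u = \<gamma> * v \<and> H v = C"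
  by (auto simp: level_curve_iff line_def H_def)

lemma level_slope_on_line:
  assumes "H v = C"
  shows "(level f C has_real_derivative - v / f (\<gamma> * v)) (at v)"
proof -
  have *: "C - v\<^sup>2 / 2 = F (\<gamma> * v)" using assms by (simp add: H_def)
  then have "v\<^sup>2 < 2 * C" using F_pos[of "\<gamma> * v"] by linarith
  from level_deriv[OF this] show ?thesis by (simp add: * slowness_def)
qed

text \<open>Equality of the slopes of line and curve at a common point is exactly \<open>H' v = 0\<close>.\<close>

lemma tangent_iff: "line_tangent_to_level \<gamma> f C \<longleftrightarrow> C = H contact"
proof
  assume "line_tangent_to_level \<gamma> f C"
  then obtain v where v: "H v = C" "(level f C has_real_derivative \<gamma>) (at v)"
    by (auto simp: line_tangent_to_level_def simp del: Int_iff simp add: level_curve_meets_line_iff)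
  then have "\<gamma> = - v / f (\<gamma> * v)"
    using level_slope_on_line DERIV_unique by blast
  then have "H' v = 0" using f_pos[of "\<gamma> * v"] by (simp add: H'_def field_simps)
  with v show "C = H contact" using contact_unique by blast
next
  assume C: "C = H contact"
  have "- contact / f (\<gamma> * contact) = \<gamma>"
    using H'_contact f_pos[of "\<gamma> * contact"] by (simp add: H'_def field_simps)
  then have "(level f C has_real_derivative \<gamma>) (at contact)"
    using level_slope_on_line[of contact C] C by simp
  then show "line_tangent_to_level \<gamma> f C"
    unfolding line_tangent_to_level_def using C level_curve_meets_line_iff by blast
qed

lemma level_even: "level f C (- v) = level f C v"
  by (simp add: level_def)

lemma tangent_reflect:
  assumes "line_tangent_to_level m f C"
  shows "line_tangent_to_level (- m) f C"
proof -
  from assms obtain v where v: "(v, m * v) \<in> level_curve f C" "(level f C has_real_derivative m) (at v)"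
    by (auto simp: line_tangent_to_level_def line_def)
  have "((\<lambda>x. level f C (- x)) has_real_derivative m * - 1) (at (- v))"
    by (rule DERIV_chain2[where g = uminus]) (use v(2) in \<open>auto intro!: derivative_eq_intros\<close>)
  then have "(level f C has_real_derivative - m) (at (- v))"
    by (simp add: level_even)
  moreover have "(- v, m * v) \<in> level_curve f C \<inter> line (- m)"
    using v(1) by (auto simp: level_curve_iff line_def)
  ultimately show ?thesis unfolding line_tangent_to_level_def by blast
qed

lemma C_tilde_eq: "C_tilde f lam \<alpha> = H contact"
  unfolding C_tilde_def
proof (rule the_equality)
  show "H contact < F 0 \<and> line_tangent_to_level \<gamma> f (H contact) \<and>
          line_tangent_to_level (- \<gamma>) f (H contact)"
    using H_decreasing[of 0 contact] contact_pos tangent_iff tangent_reflect by (simp add: H_0)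
qed (simp add: tangent_iff)

text \<open>
  To the left of the contact point \<open>H\<close> is strictly decreasing, so there \<open>w\<close> is the smaller of the at
  most two solutions of \<open>H v = H w\<close>. Hence \<open>w\<close> can replace the level \<open>C = H w\<close> as parameter.
\<close>

lemma v2_H:
  assumes "0 \<le> w" "w \<le> contact"
  shows "v2 f lam \<alpha> (H w) = w"
proof -
  let ?A = "{v. H v = H w}"
  have "fst ` (level_curve f (H w) \<inter> line \<gamma>) = ?A"
    using level_curve_meets_line_iff[of _ _ "H w"] by force
  moreover have "finite ?A"
  proof -
    have "inj_on H (?A \<inter> {..contact})" "inj_on H (?A \<inter> {contact..})"
      using H_decreasing H_increasing
      by (auto simp: inj_on_def) (metis less_irrefl linorder_less_linear)+
    moreover have "finite (H ` (?A \<inter> B))" for B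
      by (rule finite_subset[of _ "{H w}"]) auto
    ultimately have "finite (?A \<inter> {..contact})" "finite (?A \<inter> {contact..})"
      using finite_imageD by blast+
    then have "finite ((?A \<inter> {..contact}) \<union> (?A \<inter> {contact..}))" by simp
    then show ?thesis by (rule rev_finite_subset) auto
  qed
  moreover have "w \<le> v" if "H v = H w" for v
    using H_decreasing[of v w] that assms by force
  ultimately show ?thesis
    unfolding v2_def by (intro Min_eqI) auto
qed


section \<open>Dependence of the length on the level\<close>

definition travel :: "real \<Rightarrow> real" where
  "travel w = integral {0..w} (\<lambda>v. slowness (H w - v\<^sup>2 / 2))"

lemma L2_H:
  assumes "0 \<le> w" "w \<le> contact"
  shows "L2 f lam \<alpha> (H w) = 2 / sqrt lam * travel w"
proof -
  have "(\<lambda>v. 1 / (sqrt lam * f (G (H w - v\<^sup>2 / 2)))) = (\<lambda>v. 1 / sqrt lam * slowness (H w - v\<^sup>2 / 2))"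
    by (simp add: slowness_def)
  then show ?thesis
    unfolding L2_def v2_H[OF assms] travel_def by (simp del: times_divide_eq_left)
qed

lemma H_minus_ge:
  assumes "\<bar>v\<bar> \<le> w"
  shows "F (\<gamma> * w) \<le> H w - v\<^sup>2 / 2"
  using abs_le_square_iff[of v w] assms by (simp add: H_def)

lemma H_minus_pos: "\<bar>v\<bar> \<le> w \<Longrightarrow> 0 < H w - v\<^sup>2 / 2"
  using H_minus_ge F_pos order_less_le_trans by blast

lemma slowness_H_continuous: "continuous_on {0..w} (\<lambda>v. slowness (H w - v\<^sup>2 / 2))"
proof (rule slowness_on_level_continuous)
  show "v\<^sup>2 < 2 * H w" if "v \<in> {0..w}" for v
    using H_minus_pos[of v w] that by simp
qed

text \<open>
  Moving \<open>w\<close> towards the contact point lowers the level, which makes the motion slower for each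
  value of \<open>v\<close>, and also lengthens the range of \<open>v\<close>: both effects increase the travel time.
\<close>

lemma travel_strict_mono:
  assumes "0 \<le> x" "x < y" "y \<le> contact"
  shows "travel x < travel y"
proof -
  let ?q = "\<lambda>w v. slowness (H w - v\<^sup>2 / 2)"
  have int: "?q w integrable_on {a..b}" if "0 \<le> a" "b \<le> w" for a b w
    using that by (intro integrable_continuous_real continuous_on_subset[OF slowness_H_continuous]) auto
  have "H y < H x" using H_decreasing assms by simp
  then have "travel x \<le> integral {0..x} (?q y)"
    unfolding travel_def using assms
    by (intro integral_le int slowness_antimono H_minus_pos) auto
  moreover have "0 < integral {x..y} (?q y)"
  proof -
    have "0 < (y - x) * slowness (H y)" using assms slowness_pos by simp
    also have "\<dots> = integral {x..y} (\<lambda>_. slowness (H y))" using assms by simp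
    also have "\<dots> \<le> integral {x..y} (?q y)"
      using assms by (intro integral_le int slowness_antimono H_minus_pos) auto
    finally show ?thesis .
  qed
  moreover have "travel y = integral {0..x} (?q y) + integral {x..y} (?q y)"
    unfolding travel_def using assms
    by (intro Henstock_Kurzweil_Integration.integral_combine[symmetric] int) auto
  ultimately show ?thesis by simp
qed

lemma L2_strict_antimono: "strict_antimono_on {H contact..F 0} (L2 f lam \<alpha>)"
proof (rule monotone_onI)
  fix C D assume *: "C \<in> {H contact..F 0}" "D \<in> {H contact..F 0}" "C < D"
  obtain x where x: "0 \<le> x" "x \<le> contact" "H x = C" by (rule H_range[of C]) (use * in auto)
  obtain y where y: "0 \<le> y" "y \<le> contact" "H y = D" by (rule H_range[of D]) (use * in auto)
  have "y < x"
    using H_decreasing[of x y] x y *(3) by (cases x y rule: linorder_cases) auto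
  then have "travel y < travel x" using travel_strict_mono x y by simp
  then show "L2 f lam \<alpha> C > L2 f lam \<alpha> D"
    using L2_H[OF x(1,2)] L2_H[OF y(1,2)] x y lam_pos by (simp add: divide_strict_right_mono)
qed

lemma L2_s0: "L2 f lam \<alpha> (F 0) = 0"
  using L2_H[of 0] contact_pos by (simp add: H_0 travel_def)

text \<open>
  On the arc through the contact point the motion is slowest at the end points, where the tangency
  condition \<open>contact = - \<gamma> * f (\<gamma> * contact)\<close> makes \<open>contact * slowness\<close> equal to \<open>- \<gamma>\<close>.
\<close>

lemma contact_slowness: "contact * slowness (F (\<gamma> * contact)) = - \<gamma>"
  using H'_contact f_pos[of "\<gamma> * contact"] by (simp add: slowness_def H'_def field_simps)

lemma length_of_gamma: "2 / sqrt lam * - \<gamma> = - 2 / \<alpha>"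
  using lam_pos by (simp add: gamma_star_def)

lemma slowness_le_contact:
  assumes "\<bar>v\<bar> \<le> contact"
  shows "slowness (H contact - v\<^sup>2 / 2) \<le> slowness (F (\<gamma> * contact))"
  using assms by (intro slowness_antimono F_pos H_minus_ge)

text \<open>
  The deficit is the integral of a continuous nonnegative function; this gives the bound on the
  length, and a strict one as soon as that function does not vanish identically.
\<close>

lemma travel_contact_deficit:
  "- \<gamma> - travel contact =
     integral {0..contact} (\<lambda>v. slowness (F (\<gamma> * contact)) - slowness (H contact - v\<^sup>2 / 2))"
proof -
  have "integral {0..contact} (\<lambda>_. slowness (F (\<gamma> * contact))) = - \<gamma>"
    using contact_pos contact_slowness by simp
  then show ?thesis
    unfolding travel_def
    by (subst integral_diff) (auto intro!: integrable_continuous_real slowness_H_continuous)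
qed

lemma L2_contact_le: "L2 f lam \<alpha> (H contact) \<le> - 2 / \<alpha>"
proof -
  have "travel contact \<le> - \<gamma>"
  proof -
    have "0 \<le> - \<gamma> - travel contact"
      unfolding travel_contact_deficit using slowness_le_contact
      by (intro integral_nonneg integrable_continuous_real continuous_intros slowness_H_continuous) auto
    then show ?thesis by simp
  qed
  then have "2 / sqrt lam * travel contact \<le> 2 / sqrt lam * - \<gamma>"
    using lam_pos by (intro mult_left_mono) auto
  then show ?thesis using L2_H[of contact] contact_pos length_of_gamma by simp
qed

lemma L2_contact_less:
  assumes "\<not> f constant_on (snd ` arc2 f lam \<alpha> (H contact))"
  shows "L2 f lam \<alpha> (H contact) < - 2 / \<alpha>"
proof -
  obtain u where u: "u \<in> snd ` arc2 f lam \<alpha> (H contact)" "f u \<noteq> f (\<gamma> * contact)"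
    using assms unfolding constant_on_def by blast
  from u(1) obtain v where v: "\<bar>v\<bar> \<le> contact" "F u + v\<^sup>2 / 2 = H contact"
    using v2_H[of contact] contact_pos by (force simp: arc2_def level_curve_iff)
  have Fu: "H contact - v\<^sup>2 / 2 = F u" using v by simp
  let ?d = "\<lambda>v. slowness (F (\<gamma> * contact)) - slowness (H contact - v\<^sup>2 / 2)"
  have "?d \<bar>v\<bar> \<noteq> 0"
    using u(2) f_pos[of u] f_pos[of "\<gamma> * contact"] by (simp add: Fu) (simp add: slowness_def)
  moreover have cont: "continuous_on {0..contact} ?d"
    by (intro continuous_intros slowness_H_continuous)
  moreover have nonneg: "0 \<le> ?d v" if "v \<in> {0..contact}" for v
    using slowness_le_contact[of v] that by simp
  ultimately have "integral {0..contact} ?d \<noteq> 0"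
    using integral_eq_0_iff[of 0 contact ?d] contact_pos v(1) atLeastAtMost_iff abs_ge_zero by blast
  moreover have "0 \<le> integral {0..contact} ?d"
    using nonneg by (intro integral_nonneg integrable_continuous_real cont)
  ultimately have "travel contact < - \<gamma>"
    using travel_contact_deficit by simp
  then have "2 / sqrt lam * travel contact < 2 / sqrt lam * - \<gamma>"
    using lam_pos by (intro mult_strict_left_mono) auto
  then show ?thesis using L2_H[of contact] contact_pos length_of_gamma by simp
qed

text \<open>
  Rescaling \<open>v = w * t\<close> turns \<open>travel w\<close> into an integral over a fixed interval, whose integrand is
  jointly continuous in \<open>w\<close> and \<open>t\<close>.
\<close>

lemma travel_continuous: "continuous_on {0..} travel"
proof -
  have "continuous_on ({0..} \<times> cbox 0 1) (\<lambda>(w, t::real). slowness (H w - (w * t)\<^sup>2 / 2))"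
    unfolding case_prod_beta
  proof (rule continuous_on_compose2[OF slowness_continuous])
    show "continuous_on ({0..} \<times> cbox 0 1) (\<lambda>p. H (fst p) - (fst p * snd p)\<^sup>2 / 2)"
      by (intro continuous_intros continuous_on_compose2[OF H_continuous[of UNIV]]) auto
    have "\<bar>w * t\<bar> \<le> w" if "0 \<le> w" "0 \<le> t" "t \<le> 1" for w t :: real
      using that by (simp add: abs_mult mult_left_le)
    then show "(\<lambda>p. H (fst p) - (fst p * snd p)\<^sup>2 / 2) ` ({0..} \<times> cbox 0 1) \<subseteq> {0<..}"
      using H_minus_pos by fastforce
  qed
  then have "continuous_on {0..} (\<lambda>w. integral (cbox 0 1) (\<lambda>t. slowness (H w - (w * t)\<^sup>2 / 2)))"
    by (rule integral_continuous_on_param)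
  then have "continuous_on {0..} (\<lambda>w. w * integral {0..1} (\<lambda>t. slowness (H w - (w * t)\<^sup>2 / 2)))"
    by (intro continuous_intros) simp
  moreover have "w * integral {0..1} (\<lambda>t. slowness (H w - (w * t)\<^sup>2 / 2)) = travel w" if "w \<ge> 0" for w
  proof (cases "w = 0")
    case False
    with that have "w > 0" by simp
    then have "(\<lambda>x. x / w) ` {0..w} = {0..1}"
      using image_divide_atLeastAtMost[of w 0 w] by simp
    with \<open>w > 0\<close> show ?thesis
      using integral_stretch_real[of w 0 w "\<lambda>v. slowness (H w - v\<^sup>2 / 2)"] by (simp add: travel_def)
  qed (simp add: travel_def)
  ultimately show ?thesis by (subst continuous_on_cong[symmetric, OF refl]) auto
qed

lemma L2_surj:
  assumes "0 < L" "L < L2 f lam \<alpha> (H contact)"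
  obtains w where "0 < w" "w < contact" "L2 f lam \<alpha> (H w) = L"
proof -
  let ?g = "\<lambda>w. 2 / sqrt lam * travel w"
  have g: "?g 0 = 0" "?g contact = L2 f lam \<alpha> (H contact)"
    using L2_H[of contact] contact_pos by (auto simp: travel_def)
  have "continuous_on {0..contact} ?g"
    by (intro continuous_intros continuous_on_subset[OF travel_continuous]) auto
  then obtain w where w: "0 \<le> w" "w \<le> contact" "?g w = L"
    using IVT'[of ?g 0 L contact] g assms contact_pos by force
  moreover have "w \<noteq> 0" "w \<noteq> contact" using w(3) g assms by auto
  ultimately show thesis using that[of w] L2_H[of w] by simp
qed

end

section \<open>Arcs and solutions\<close>

text \<open>
  Antisymmetrising any antiderivative of an even function leaves an antiderivative.
\<close>

lemma odd_antiderivative: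
  fixes q :: "real \<Rightarrow> real"
  assumes "continuous_on {-b..b} q" and even: "\<And>v. q (- v) = q v"
  obtains T where "\<And>v. \<bar>v\<bar> < b \<Longrightarrow> (T has_real_derivative q v) (at v)" "\<And>v. T (- v) = - T v"
proof -
  define S where "S v = integral {-b..v} q" for v
  have S: "(S has_real_derivative q v) (at v)" if "\<bar>v\<bar> < b" for v
  proof -
    have "(S has_real_derivative q v) (at v within {-b..b})"
      unfolding S_def using that by (intro integral_has_real_derivative assms(1)) auto
    then have "(S has_real_derivative q v) (at v within {-b<..<b})"
      by (rule DERIV_subset) auto
    moreover have "v \<in> {-b<..<b}" using that by auto
    ultimately show ?thesis by (simp add: at_within_open[of v "{-b<..<b}"])
  qed
  show thesis
  proof
    show "((\<lambda>v. (S v - S (- v)) / 2) has_real_derivative q v) (at v)" if "\<bar>v\<bar> < b" for v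
    proof -
      have "((\<lambda>v. S (- v)) has_real_derivative q (- v) * - 1) (at v)"
        by (rule DERIV_chain2[OF S]) (use that in \<open>auto intro!: derivative_eq_intros\<close>)
      from DERIV_cdivide[OF DERIV_diff[OF S[OF that] this], of 2] show ?thesis
        by (simp add: even)
    qed
  qed (simp add: field_simps)
qed

context robin_problem
begin

text \<open>
  The clock \<open>T\<close> assigns to \<open>v\<close> the (reversed) time at which the trajectory passes through \<open>v\<close>,
  counted from the \<open>u\<close>-axis. It is defined slightly beyond \<open>[-w, w]\<close>, so that it and its inverse
  have two-sided derivatives at the end points of the arc.
\<close>

lemma clock:
  assumes "0 < w" "w < contact"
  obtains T b where "w < b" "\<And>v. \<bar>v\<bar> < b \<Longrightarrow> v\<^sup>2 < 2 * H w"
    "\<And>v. \<bar>v\<bar> < b \<Longrightarrow> (T has_real_derivative slowness (H w - v\<^sup>2 / 2) / sqrt lam) (at v)"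
    "\<And>v. T (- v) = - T v" "2 * T w = L2 f lam \<alpha> (H w)"
proof -
  let ?q = "\<lambda>v. slowness (H w - v\<^sup>2 / 2) / sqrt lam"
  have "w < sqrt (2 * H w)"
    using H_minus_pos[of w w] assms by (intro real_less_rsqrt) simp
  then obtain b where b: "w < b" "b < sqrt (2 * H w)" using dense by blast
  have less: "v\<^sup>2 < 2 * H w" if "\<bar>v\<bar> \<le> b" for v
  proof -
    have "\<bar>v\<bar> < sqrt (2 * H w)" using that b by simp
    then show ?thesis using real_sqrt_less_iff[of "v\<^sup>2" "2 * H w"] by simp
  qed
  have "continuous_on {-b..b} ?q"
    using lam_pos by (intro continuous_intros slowness_on_level_continuous less) auto
  then obtain T where T: "\<And>v. \<bar>v\<bar> < b \<Longrightarrow> (T has_real_derivative ?q v) (at v)"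
      "\<And>v. T (- v) = - T v"
    by (rule odd_antiderivative) auto
  have "(?q has_integral T w - T 0) {0..w}"
  proof (rule fundamental_theorem_of_calculus)
    show "(T has_vector_derivative ?q v) (at v within {0..w})" if "v \<in> {0..w}" for v
      using T(1)[of v] that b
      by (auto simp: has_real_derivative_iff_has_vector_derivative intro: has_vector_derivative_at_within)
  qed (use assms in simp)
  moreover have "T 0 = 0" using T(2)[of 0] by simp
  ultimately have "T w - 0 = integral {0..w} ?q" by (simp only: integral_unique)
  then have "2 * T w = L2 f lam \<alpha> (H w)"
    using L2_H[of w] assms by (simp add: travel_def)
  then show thesis using that[of b T] b(1) less T by auto
qed

lemma arc2_iff:
  assumes "0 \<le> w" "w \<le> contact"
  shows "(v, u) \<in> arc2 f lam \<alpha> (H w) \<longleftrightarrow> F u + v\<^sup>2 / 2 = H w \<and> \<bar>v\<bar> \<le> w"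
  using assms by (auto simp: arc2_def level_curve_iff v2_H)

text \<open>
  Along a solution the clock runs backwards at unit rate, so it measures the length of the interval.
\<close>

lemma represented_imp_length:
  assumes w: "0 < w" "w < contact" and "0 < L"
    and sol: "robin_solution f lam \<alpha> L u u'"
    and rep: "represented_by_arc2 f lam \<alpha> (H w) L u u'"
  shows "L2 f lam \<alpha> (H w) = L"
proof -
  obtain T b where b: "w < b"
    and T: "\<And>v. \<bar>v\<bar> < b \<Longrightarrow> (T has_real_derivative slowness (H w - v\<^sup>2 / 2) / sqrt lam) (at v)"
    and odd: "\<And>v. T (- v) = - T v" and Tw: "2 * T w = L2 f lam \<alpha> (H w)"
    using clock[OF w] by metis
  define v where "v x = u' x / sqrt lam" for x
  have ends: "v 0 = w" "v L = - w"
    using rep w by (auto simp: represented_by_arc2_def Let_def P2_plus_def P2_minus_def v2_H v_def)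
  have arc: "F (u x) + (v x)\<^sup>2 / 2 = H w" "\<bar>v x\<bar> \<le> w" if "x \<in> {0..L}" for x
  proof -
    have "(v x, u x) \<in> arc2 f lam \<alpha> (H w)"
      using rep that unfolding represented_by_arc2_def Let_def v_def by blast
    then show "F (u x) + (v x)\<^sup>2 / 2 = H w" "\<bar>v x\<bar> \<le> w"
      using w by (simp_all add: arc2_iff)
  qed
  have T_cont: "continuous_on {-w..w} T"
    by (rule DERIV_continuous_on, rule DERIV_subset[OF T]) (use b in auto)
  have v_cont: "continuous_on {0..L} v"
    unfolding v_def using sol lam_pos
    by (intro continuous_intros) (auto simp: robin_solution_def)
  have "T (v L) + L = T (v 0) + 0"
  proof (rule DERIV_isconst_end[OF \<open>0 < L\<close>])
    show "continuous_on {0..L} (\<lambda>x. T (v x) + x)"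
      using arc(2) by (intro continuous_intros continuous_on_compose2[OF T_cont v_cont]) (force simp: abs_le_iff)
  next
    fix x assume x: "0 < x" "x < L"
    obtain d where "(u' has_real_derivative d) (at x)" "d + lam * f (u x) = 0"
      using sol x unfolding robin_solution_def by (metis greaterThanLessThan_iff)
    then have "(v has_real_derivative - (lam * f (u x)) / sqrt lam) (at x)"
      unfolding v_def using DERIV_cdivide by (metis add_eq_0_iff2)
    moreover have "H w - (v x)\<^sup>2 / 2 = F (u x)" "\<bar>v x\<bar> < b"
      using arc[of x] x b by auto
    then have "(T has_real_derivative 1 / f (u x) / sqrt lam) (at (v x))"
      using T[of "v x"] by (simp add: slowness_def)
    ultimately have "((\<lambda>x. T (v x)) has_real_derivative
        1 / f (u x) / sqrt lam * (- (lam * f (u x)) / sqrt lam)) (at x)"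
      by (rule DERIV_chain2[rotated])
    moreover have "1 / f (u x) / sqrt lam * (- (lam * f (u x)) / sqrt lam) = - 1"
      using f_pos[of "u x"] lam_pos by (simp add: field_simps)
    ultimately show "((\<lambda>x. T (v x) + x) has_real_derivative 0) (at x)"
      by (auto intro!: derivative_eq_intros)
  qed
  then show ?thesis using ends odd Tw by simp
qed

text \<open>Conversely, inverting the clock parametrises the arc by a solution.\<close>

lemma length_imp_represented:
  assumes w: "0 < w" "w < contact" and L: "L2 f lam \<alpha> (H w) = L"
  shows "\<exists>u u'. robin_solution f lam \<alpha> L u u' \<and> symmetric_on L u \<and>
           represented_by_arc2 f lam \<alpha> (H w) L u u'"
proof -
  obtain T b where b: "w < b" and less: "\<And>v. \<bar>v\<bar> < b \<Longrightarrow> v\<^sup>2 < 2 * H w"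
    and T: "\<And>v. \<bar>v\<bar> < b \<Longrightarrow> (T has_real_derivative slowness (H w - v\<^sup>2 / 2) / sqrt lam) (at v)"
    and odd: "\<And>v. T (- v) = - T v" and Tw2: "2 * T w = L2 f lam \<alpha> (H w)"
    using clock[OF w] by metis
  have Tw: "T w = L / 2" using Tw2 L by simp
  have T_mono: "T x < T y" if "- b < x" "x < y" "y < b" for x y
  proof (rule DERIV_pos_imp_increasing[OF that(2)])
    fix z assume "x \<le> z" "z \<le> y"
    then have "\<bar>z\<bar> < b" using that by (simp add: abs_less_iff)
    moreover have "0 < slowness (H w - z\<^sup>2 / 2) / sqrt lam"
      using slowness_pos lam_pos by simp
    ultimately show "\<exists>d. (T has_real_derivative d) (at z) \<and> 0 < d" using T by blast
  qed
  define V where "V = inv_into {-b<..<b} T"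
  have "inj_on T {-b<..<b}"
    by (rule linorder_inj_onI) (use T_mono in force)+
  then have V_T: "V (T v) = v" if "\<bar>v\<bar> < b" for v
    unfolding V_def using that by (intro inv_into_f_f) (auto simp: abs_less_iff)
  have T_cont: "continuous_on {-b<..<b} T"
    by (rule DERIV_continuous_on, rule DERIV_subset[OF T]) auto
  have T_le: "\<bar>T v\<bar> \<le> L / 2" if "\<bar>v\<bar> \<le> w" for v
  proof -
    have "v = w \<or> v < w" "v = - w \<or> - w < v" using that by auto
    then have "T v \<le> T w" "T (- w) \<le> T v"
      using T_mono[of v w] T_mono[of "-w" v] that b by (auto simp: abs_le_iff)
    then show ?thesis using Tw odd by (simp add: abs_le_iff)
  qed
  have V: "T (V y) = y" "\<bar>V y\<bar> \<le> w" if y: "\<bar>y\<bar> \<le> L / 2" for y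
  proof -
    have "continuous_on {-w..w} T" by (rule continuous_on_subset[OF T_cont]) (use b in auto)
    then obtain v where "- w \<le> v" "v \<le> w" "T v = y"
      using IVT'[of T "-w" y w] w y Tw odd[of w] by (auto simp: abs_le_iff)
    then show "T (V y) = y" "\<bar>V y\<bar> \<le> w" using V_T[of v] b by auto
  qed
  have V_odd: "V (- y) = - V y" if "\<bar>y\<bar> \<le> L / 2" for y
    using V_T[of "- V y"] V[OF that] odd[of "V y"] b by simp
  have centred: "\<bar>x - L / 2\<bar> \<le> L / 2" if "x \<in> {0..L}" for x
    using that by (intro abs_leI) auto
  define u where "u x = level f (H w) (V (x - L / 2))" for x
  define u' where "u' x = - sqrt lam * V (x - L / 2)" for x
  have ends: "V (- L / 2) = - w" "V (L / 2) = w"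
    using V_T[of w] V_T[of "-w"] b w odd[of w] Tw by auto
  have level_w: "level f (H w) w = \<gamma> * w"
    by (simp add: level_def H_def)
  have V_deriv: "((\<lambda>x. V (x - L / 2)) has_real_derivative sqrt lam * f (u x)) (at x)"
    if "x \<in> {0..L}" for x
  proof -
    let ?v = "V (x - L / 2)"
    have x: "\<bar>x - L / 2\<bar> \<le> L / 2" using that by (rule centred)
    have "(V has_real_derivative inverse (slowness (H w - ?v\<^sup>2 / 2) / sqrt lam)) (at (T ?v))"
    proof (rule has_real_derivative_local_inverse[OF _ _ T_cont V_T T])
      show "slowness (H w - ?v\<^sup>2 / 2) / sqrt lam \<noteq> 0"
        using slowness_pos[of "H w - ?v\<^sup>2 / 2"] lam_pos by simp
    qed (use V(2)[OF x] b in auto)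
    moreover have "inverse (slowness (H w - ?v\<^sup>2 / 2) / sqrt lam) = sqrt lam * f (u x)"
      by (simp add: slowness_def u_def level_def)
    ultimately have "(V has_real_derivative sqrt lam * f (u x)) (at (x - L / 2))"
      using V(1)[OF x] by simp
    moreover have "((\<lambda>x. x - L / 2) has_real_derivative 1) (at x)"
      by (auto intro!: derivative_eq_intros)
    ultimately have "((\<lambda>x. V (x - L / 2)) has_real_derivative sqrt lam * f (u x) * 1) (at x)"
      by (rule DERIV_chain2)
    then show ?thesis by simp
  qed
  have u_deriv: "(u has_real_derivative u' x) (at x)" if "x \<in> {0..L}" for x
  proof -
    let ?v = "V (x - L / 2)"
    have "\<bar>?v\<bar> < b" using V(2)[OF centred[OF that]] b by simp
    then have "(level f (H w) has_real_derivative - ?v * slowness (H w - ?v\<^sup>2 / 2)) (at ?v)"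
      by (intro level_deriv less)
    from DERIV_chain2[OF this V_deriv[OF that]] show ?thesis
      using f_pos[of "u x"] by (simp add: u_def[abs_def] u'_def slowness_def level_def mult.commute)
  qed
  have u'_deriv: "(u' has_real_derivative - lam * f (u x)) (at x)" if "x \<in> {0..L}" for x
    using DERIV_cmult[OF V_deriv[OF that], of "- sqrt lam"] lam_pos by (simp add: u'_def[abs_def] flip: mult.assoc)
  have "robin_solution f lam \<alpha> L u u'"
    unfolding robin_solution_def
  proof (intro conjI ballI)
    show "(u has_real_derivative u' x) (at x within {0..L})" if "x \<in> {0..L}" for x
      using u_deriv[OF that] by (rule DERIV_subset) simp
    show "continuous_on {0..L} u'"
      by (rule DERIV_continuous_on, rule DERIV_subset[OF u'_deriv]) auto
    show "\<exists>d. (u' has_real_derivative d) (at x) \<and> d + lam * f (u x) = 0" if "x \<in> {0<..<L}" for x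
      using u'_deriv[of x] that by (intro exI[of _ "- lam * f (u x)"]) simp
    show "u' 0 = \<alpha> * u 0" "u' L = - \<alpha> * u L"
      using ends alpha_neg by (simp_all add: u_def u'_def level_even level_w gamma_star_def)
  qed
  moreover have "symmetric_on L u"
    unfolding symmetric_on_def
  proof
    fix x assume x: "x \<in> {0..L}"
    have "V (L - x - L / 2) = - V (x - L / 2)"
      using V_odd[OF centred[OF x]] by (simp add: algebra_simps)
    then show "u (L - x) = u x" by (simp add: u_def level_even)
  qed
  moreover have "represented_by_arc2 f lam \<alpha> (H w) L u u'"
  proof -
    let ?traj = "\<lambda>x. (u' x / sqrt lam, u x)"
    have traj: "?traj x = (- V (x - L / 2), level f (H w) (V (x - L / 2)))" for x
      using lam_pos by (simp add: u_def u'_def)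
    have on_arc: "(v, level f (H w) v) \<in> arc2 f lam \<alpha> (H w) \<longleftrightarrow> \<bar>v\<bar> \<le> w" for v
      using w H_minus_pos[of v w] by (auto simp: arc2_iff level_def F_G)
    have "?traj ` {0..L} = arc2 f lam \<alpha> (H w)"
    proof
      show "?traj ` {0..L} \<subseteq> arc2 f lam \<alpha> (H w)"
      proof
        fix p assume "p \<in> ?traj ` {0..L}"
        then obtain x where x: "x \<in> {0..L}" and p: "p = ?traj x" by blast
        then show "p \<in> arc2 f lam \<alpha> (H w)"
          using on_arc[of "- V (x - L / 2)"] V(2)[OF centred[OF x]] unfolding p traj
          by (simp add: level_even)
      qed
      show "arc2 f lam \<alpha> (H w) \<subseteq> ?traj ` {0..L}"
      proof
        fix p assume p: "p \<in> arc2 f lam \<alpha> (H w)"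
        then obtain v where p_eq: "p = (v, level f (H w) v)"
          by (auto simp: arc2_def level_curve_def)
        with p on_arc have v: "\<bar>v\<bar> \<le> w" by blast
        have "V (T (- v)) = - v" using V_T[of "-v"] v b by simp
        then have at_time: "p = ?traj (L / 2 + T (- v))"
          unfolding traj p_eq by (simp add: level_even)
        have "L / 2 + T (- v) \<in> {0..L}"
          using abs_le_D1[OF T_le[of "-v"]] abs_le_D2[OF T_le[of "-v"]] v by simp
        then show "p \<in> ?traj ` {0..L}" by (subst at_time) (rule imageI)
      qed
    qed
    moreover have "?traj 0 = P2_plus f lam \<alpha> (H w)" "?traj L = P2_minus f lam \<alpha> (H w)"
      using ends w unfolding traj
      by (simp_all add: P2_plus_def P2_minus_def v2_H level_even level_w)
    ultimately show ?thesis unfolding represented_by_arc2_def Let_def by blast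
  qed
  ultimately show ?thesis by blast
qed

end

section \<open>The length as a function of the level\<close>

theorem theorem3p11:
  fixes f f' :: "real \<Rightarrow> real" and lam \<alpha> :: real
  assumes "\<alpha> < 0" and "lam > 0"
    and "\<And>u. (f has_real_derivative f' u) (at u)" and "continuous_on UNIV f'"
    and "\<And>u. f u > 0" and "\<And>u. f' u \<ge> 0"
    and "filterlim (\<lambda>u. f u / u) at_top at_top"
    and "f integrable_on {..0}"
  defines "s0 \<equiv> primitive f 0" and "Ct \<equiv> C_tilde f lam \<alpha>" and "L0 \<equiv> L2 f lam \<alpha> (C_tilde f lam \<alpha>)"
  shows "strict_antimono_on {Ct..s0} (L2 f lam \<alpha>)
    \<and> L2 f lam \<alpha> s0 = 0
    \<and> L0 \<le> - 2 / \<alpha>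
    \<and> (\<not> f constant_on (snd ` arc2 f lam \<alpha> Ct) \<longrightarrow> L0 < - 2 / \<alpha>)
    \<and> (\<forall>L\<in>{0<..<L0}.
          (\<exists>!C. C \<in> {Ct<..<s0} \<and> L2 f lam \<alpha> C = L)
        \<and> (\<forall>C\<in>{Ct<..<s0}. L2 f lam \<alpha> C = L \<longleftrightarrow>
              (\<exists>u u'. robin_solution f lam \<alpha> L u u' \<and> symmetric_on L u \<and>
                 represented_by_arc2 f lam \<alpha> C L u u')))"
proof -
  interpret robin_problem f f' lam \<alpha>
    by unfold_locales (use assms in auto)
  have Ct: "Ct = H contact" and L0: "L0 = L2 f lam \<alpha> (H contact)"
    by (simp_all add: Ct_def L0_def C_tilde_eq)
  have "\<exists>!C. C \<in> {Ct<..<s0} \<and> L2 f lam \<alpha> C = L" if L: "L \<in> {0<..<L0}" for L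
  proof (rule ex_ex1I)
    obtain w where w: "0 < w" "w < contact" "L2 f lam \<alpha> (H w) = L"
      using L2_surj L L0 by auto
    have "H w \<in> {Ct<..<s0}"
      using w H_decreasing[of 0 w] H_decreasing[of w contact] by (simp add: Ct s0_def H_0)
    with w show "\<exists>C. C \<in> {Ct<..<s0} \<and> L2 f lam \<alpha> C = L" by blast
  next
    fix C D assume "C \<in> {Ct<..<s0} \<and> L2 f lam \<alpha> C = L" "D \<in> {Ct<..<s0} \<and> L2 f lam \<alpha> D = L"
    then show "C = D"
      using monotone_onD[OF L2_strict_antimono, of C D] monotone_onD[OF L2_strict_antimono, of D C]
      by (cases C D rule: linorder_cases) (auto simp: Ct s0_def)
  qed
  moreover have "L2 f lam \<alpha> C = L \<longleftrightarrow>
      (\<exists>u u'. robin_solution f lam \<alpha> L u u' \<and> symmetric_on L u \<and> represented_by_arc2 f lam \<alpha> C L u u')"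
    if L: "L \<in> {0<..<L0}" and C: "C \<in> {Ct<..<s0}" for L C
  proof -
    obtain w where w: "0 \<le> w" "w \<le> contact" "H w = C"
      by (rule H_range[of C]) (use C in \<open>auto simp: Ct s0_def\<close>)
    with C have "0 < w" "w < contact" by (auto simp: Ct s0_def H_0 less_le)
    then show ?thesis
      using represented_imp_length[of w L] length_imp_represented[of w L] L w(3) by auto
  qed
  ultimately show ?thesis
    using L2_strict_antimono L2_s0 L2_contact_le L2_contact_less by (simp add: Ct L0 s0_def)
qed

end
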